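(* Let $\alpha>0$ and let $0\le\nu_0<\nu$ be real numbers. Then $$\lim_{t\to0^{+}}D_{\nu-\nu_{0}}^{-\alpha}Y_{\nu}(t)=-\infty\qquad\text{and}\qquad\lim_{t\to0^{+}}D_{\nu-\nu_{0}}^{-\alpha}K_{\nu}(t)=\infty .$$
   Context: $Y_\nu$ is the Bessel function of the second kind and $K_\nu$ is the Macdonald function (modified Bessel function of the second kind). Fractional integration with respect to the order is $$D_{\nu-\nu_0}^{-\alpha}f(\nu)=\frac{1}{\Gamma(\alpha)}\int_{\nu_0}^{\nu}(\nu-\mu)^{\alpha-1}f(\mu)\,d\mu ,$$ applied with $f(\mu)=Y_\mu(t)$ or $f(\mu)=K_\mu(t)$, $t>0$ fixed. *)

theory Defs
  imports "HOL-Analysis.Analysis"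
begin

text \<open>
  All functions of Bessel type are taken at a real order \<open>\<nu>\<close> and a real argument \<open>t > 0\<close>, so that
  the powers of \<open>t / 2\<close> are the real ones. Writing the series with the reciprocal Gamma function
  gives the usual convention \<open>1 / \<Gamma>(-m) = 0\<close> at negative integer orders.
\<close>

definition bessel_J :: "real \<Rightarrow> real \<Rightarrow> real" where
  "bessel_J \<nu> t = (\<Sum>k. (-1) ^ k / fact k * rGamma (real k + \<nu> + 1) * (t / 2) powr (2 * real k + \<nu>))"

definition bessel_I :: "real \<Rightarrow> real \<Rightarrow> real" where
  "bessel_I \<nu> t = (\<Sum>k. 1 / fact k * rGamma (real k + \<nu> + 1) * (t / 2) powr (2 * real k + \<nu>))"

text \<open>
  At integer orders the defining quotients are \<open>0 / 0\<close>, and the functions of the second kind are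
  the limits of the quotients with respect to the order.
\<close>

definition bessel_Y :: "real \<Rightarrow> real \<Rightarrow> real" where
  "bessel_Y \<nu> t =
     (let q = (\<lambda>\<mu>. (bessel_J \<mu> t * cos (\<mu> * pi) - bessel_J (-\<mu>) t) / sin (\<mu> * pi))
      in if \<nu> \<in> \<int> then Lim (at \<nu>) q else q \<nu>)"

definition bessel_K :: "real \<Rightarrow> real \<Rightarrow> real" where
  "bessel_K \<nu> t =
     (let q = (\<lambda>\<mu>. pi / 2 * (bessel_I (-\<mu>) t - bessel_I \<mu> t) / sin (\<mu> * pi))
      in if \<nu> \<in> \<int> then Lim (at \<nu>) q else q \<nu>)"

text \<open>
  The Riemann--Liouville integral of order \<open>\<alpha> > 0\<close> with base point \<open>\<nu>\<^sub>0\<close>, evaluated at \<open>\<nu>\<close>, as a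
  Lebesgue integral. The value \<open>0 powr (\<alpha> - 1) = 0\<close> at the endpoint \<open>\<mu> = \<nu>\<close> is immaterial.
\<close>

definition frac_integral :: "real \<Rightarrow> real \<Rightarrow> (real \<Rightarrow> real) \<Rightarrow> real \<Rightarrow> real" where
  "frac_integral \<alpha> \<nu>\<^sub>0 f \<nu> =
     1 / Gamma \<alpha> * (LBINT \<mu>:{\<nu>\<^sub>0..\<nu>}. (\<nu> - \<mu>) powr (\<alpha> - 1) * f \<mu>)"

end

theory Submission
  imports Defs "HOL-Complex_Analysis.Conformal_Mappings"
begin

text \<open>
  With \<open>x = t / 2\<close>, the functions \<open>-Y\<close> and \<open>K\<close> of order \<open>\<mu>\<close> are positive multiples of \<open>N(\<mu>) / sin (\<mu> \<pi>)\<close>,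
  where \<open>N(z) = x\<^sup>-\<^sup>z E(-z) - c(z) x\<^sup>z E(z)\<close> is entire in the order and vanishes at the integers, and
  \<open>E(z) = \<Sum>\<^sub>k (\<plusminus>x\<^sup>2)\<^sup>k / (k! \<Gamma>(k + 1 + z)) = 1 / \<Gamma>(1 + z) + O(x\<^sup>2)\<close>. An entire function bounded by \<open>B\<close> on a disc of radius \<open>1/2\<close> about
  an integer \<open>n\<close> and vanishing at \<open>n\<close> is at most \<open>B \<bar>sin (\<mu> \<pi>)\<bar>\<close> on the real diameter, by the Schwarz
  lemma and Jordan's inequality. Applied to \<open>N\<close> this gives integrability in the order. Applied to
  \<open>N\<close> minus its leading term it bounds the error near \<open>n\<close>: the quotient is
  \<open>x\<^sup>-\<^sup>\<mu> \<Gamma>(\<mu>) / \<pi> + O(x\<^bsup>3/2 - n\<^esup>)\<close> for \<open>n \<ge> 1\<close>, and at least of order \<open>-ln x\<close> for \<open>n = 0\<close>. So the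
  integrand tends to infinity uniformly in the noninteger orders.
\<close>

section \<open>The entire factor of the Bessel series\<close>

text \<open>For \<open>y = - x^2\<close> and \<open>y = x^2\<close>, multiplication by
  \<open>x^z\<close> gives \<open>J_z(2 x)\<close> and \<open>I_z(2 x)\<close>; this is the
  regularized hypergeometric function 0F1. With the power split off, what remains is entire in the
  order \<open>z\<close>.\<close>

definition bessel_entire :: "complex \<Rightarrow> complex \<Rightarrow> complex" where
  "bessel_entire y z = (\<Sum>k. y ^ k / fact k * rGamma (of_nat k + z + 1))"

text \<open>Once \<open>k \<ge> M\<close>, the factor in
  \<open>rGamma w = w * rGamma (w + 1)\<close> has norm at least 1, so the norms no longer increase
  with \<open>k\<close>; the finitely many earlier ones are bounded by compactness. Independence of
  \<open>k\<close> lets the exponential series majorize the Bessel series.\<close>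

lemma rGamma_shift_bounded:
  obtains A where "A > 0" and "\<And>k z. norm (z :: complex) \<le> M \<Longrightarrow> norm (rGamma (of_nat k + z + 1)) \<le> A"
proof -
  define N where "N = nat \<lceil>M\<rceil>"
  define F where "F z = (\<Sum>k\<le>N. norm (rGamma (of_nat k + z + 1)))" for z :: complex
  have "continuous_on (cball 0 M) F"
    unfolding F_def
    by (intro continuous_on_sum continuous_on_norm holomorphic_on_imp_continuous_on holomorphic_intros)
  then have "bounded (F ` cball 0 M)"
    by (intro compact_imp_bounded compact_continuous_image) auto
  then obtain A where "A > 0" and A: "\<And>z. norm z \<le> M \<Longrightarrow> norm (F z) \<le> A"
    by (auto simp: bounded_pos)
  have "norm (rGamma (of_nat k + z + 1)) \<le> A" if z: "norm z \<le> M" for k and z :: complex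
  proof (cases "k \<le> N")
    case True
    have "norm (rGamma (of_nat k + z + 1)) \<le> F z"
      unfolding F_def using True by (intro member_le_sum) auto
    with A[OF z] show ?thesis by auto
  next
    case False
    then have "N \<le> k" by simp
    then show ?thesis
    proof (induction k rule: dec_induct)
      case base
      have "norm (rGamma (of_nat N + z + 1)) \<le> F z"
        unfolding F_def by (intro member_le_sum) auto
      with A[OF z] show ?case by auto
    next
      case (step k)
      define w where "w = of_nat k + z + 1"
      have "real k \<ge> M" using step(1) unfolding N_def by linarith
      moreover have "norm (of_nat (Suc k) :: complex) \<le> norm w + norm z"
        unfolding w_def using norm_triangle_ineq4[of "of_nat k + z + 1" z] by (simp add: algebra_simps)
      ultimately have "norm w \<ge> 1" using z
        by (smt (verit) norm_of_nat of_nat_Suc)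
      have "norm (rGamma (w + 1)) \<le> norm w * norm (rGamma (w + 1))"
        using \<open>norm w \<ge> 1\<close> by (simp add: mult_le_cancel_right1)
      also have "\<dots> = norm (rGamma w)"
        by (metis norm_mult rGamma_plus1)
      finally show ?case using step.IH by (simp add: w_def algebra_simps)
    qed
  qed
  with \<open>A > 0\<close> show thesis by (rule that)
qed

lemma summable_bessel_entire: "summable (\<lambda>k. norm (y ^ k / fact k * rGamma (of_nat k + z + 1) :: complex))"
proof -
  obtain A where A: "A > 0" "\<And>k. norm (rGamma (of_nat k + z + 1)) \<le> A"
    using rGamma_shift_bounded[of "norm z"] by (metis order_refl)
  show ?thesis
  proof (rule summable_comparison_test')
    show "summable (\<lambda>k. norm y ^ k / fact k * A)"
      using summable_mult2[OF summable_exp[of "norm y"], of A] by (simp add: field_simps)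
    show "norm (norm (y ^ k / fact k * rGamma (of_nat k + z + 1))) \<le> norm y ^ k / fact k * A" if "k \<ge> 0" for k
      using A(2)[of k] by (simp add: norm_mult norm_divide norm_power divide_right_mono mult_left_mono)
  qed
qed

lemma holomorphic_bessel_entire: "bessel_entire y holomorphic_on UNIV"
proof (rule holomorphic_uniform_sequence)
  fix z :: complex
  obtain A where A: "A > 0" "\<And>k w. norm (w :: complex) \<le> norm z + 1 \<Longrightarrow> norm (rGamma (of_nat k + w + 1)) \<le> A"
    using rGamma_shift_bounded[of "norm z + 1"] by metis
  have "uniform_limit (cball z 1) (\<lambda>n w. \<Sum>k<n. y ^ k / fact k * rGamma (of_nat k + w + 1))
          (bessel_entire y) sequentially"
    unfolding bessel_entire_def
  proof (rule Weierstrass_m_test)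
    show "summable (\<lambda>k. norm y ^ k / fact k * A)"
      using summable_mult2[OF summable_exp[of "norm y"], of A] by (simp add: field_simps)
    show "norm (y ^ k / fact k * rGamma (of_nat k + w + 1)) \<le> norm y ^ k / fact k * A"
      if "w \<in> cball z 1" for k w
    proof -
      have "norm w \<le> norm z + 1"
        using that norm_triangle_ineq2[of w z] by (simp add: dist_norm norm_minus_commute)
      from A(2)[OF this, of k] show ?thesis
        by (simp add: norm_mult norm_divide norm_power divide_right_mono mult_left_mono)
    qed
  qed
  then show "\<exists>d>0. cball z d \<subseteq> UNIV \<and>
      uniform_limit (cball z d) (\<lambda>n w. \<Sum>k<n. y ^ k / fact k * rGamma (of_nat k + w + 1)) (bessel_entire y) sequentially"
    by (intro exI[of _ 1]) auto
qed (auto intro!: holomorphic_intros)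

text \<open>One constant serves the whole unit disc of \<open>y\<close>, so the bounds stay uniform
  as \<open>x\<close> tends to 0. With \<open>norm y = x^2\<close>, the second bound says that the
  term \<open>k = 0\<close> dominates.\<close>

lemma bessel_entire_bounds:
  obtains A where "A > 0"
    and "\<And>y z. norm y \<le> 1 \<Longrightarrow> norm z \<le> M \<Longrightarrow> norm (bessel_entire y z) \<le> A"
    and "\<And>y z. norm y \<le> 1 \<Longrightarrow> norm z \<le> M \<Longrightarrow> norm (bessel_entire y z - rGamma (z + 1)) \<le> A * norm y"
proof -
  obtain A where A: "A > 0" "\<And>k z. norm (z :: complex) \<le> M \<Longrightarrow> norm (rGamma (of_nat k + z + 1)) \<le> A"
    using rGamma_shift_bounded[of M] by metis
  have tail: "norm (bessel_entire y z - rGamma (z + 1)) \<le> A * exp 1 * norm y"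
    if y: "norm y \<le> 1" and z: "norm z \<le> M" for y z
  proof -
    let ?f = "\<lambda>k. y ^ k / fact k * rGamma (of_nat k + z + 1)"
    have sum: "summable (\<lambda>k. norm (?f k))" by (rule summable_bessel_entire)
    have "bessel_entire y z - rGamma (z + 1) = (\<Sum>k. ?f (Suc k))"
      unfolding bessel_entire_def
      using suminf_split_head[OF summable_norm_cancel[OF sum]] by simp
    \<comment> \<open>After the index shift one factor \<open>norm y\<close> survives:
      \<open>|y|^(k+1) / (k+1)! \<le> |y| / k!\<close> for \<open>|y| \<le> 1\<close>.\<close>
    also have "norm \<dots> \<le> (\<Sum>k. 1 / fact k * (A * norm y))"
    proof (rule norm_suminf_le)
      show "summable (\<lambda>k. 1 / fact k * (A * norm y))"
        using summable_mult2[OF summable_exp[of 1], of "A * norm y"] by (simp add: field_simps)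
      show "norm (?f (Suc k)) \<le> 1 / fact k * (A * norm y)" for k
      proof -
        have "norm y ^ Suc k \<le> norm y"
          using power_decreasing[of 1 "Suc k" "norm y"] y by simp
        moreover have "inverse (fact (Suc k)) \<le> (inverse (fact k) :: real)"
          by (intro le_imp_inverse_le fact_mono) auto
        ultimately have "norm y ^ Suc k * inverse (fact (Suc k)) \<le> norm y * inverse (fact k)"
          by (intro mult_mono) (auto simp del: fact_Suc power_Suc)
        then have "norm y ^ Suc k * inverse (fact (Suc k)) * norm (rGamma (of_nat (Suc k) + z + 1))
              \<le> norm y * inverse (fact k) * A"
          by (rule mult_mono[OF _ A(2)[OF z]]) auto
        then show ?thesis by (simp add: norm_mult norm_divide norm_power field_simps del: fact_Suc of_nat_Suc)
      qed
    qed
    also have "\<dots> = exp 1 * (A * norm y)"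
      using sums_mult2[OF exp_converges[of "1::real"], of "A * norm y"]
      by (simp add: sums_iff field_simps)
    finally show ?thesis by (simp add: mult_ac)
  qed
  show thesis
  proof (rule that[of "A * exp 1 + A"])
    show "A * exp 1 + A > 0" using A(1) by (simp add: add_pos_pos)
    fix y z :: complex assume y: "norm y \<le> 1" and z: "norm z \<le> M"
    have "norm (bessel_entire y z) \<le> norm (bessel_entire y z - rGamma (z + 1)) + norm (rGamma (z + 1))"
      using norm_triangle_ineq[of "bessel_entire y z - rGamma (z + 1)" "rGamma (z + 1)"] by simp
    also have "\<dots> \<le> A * exp 1 * norm y + A"
      using tail[OF y z] A(2)[OF z, of 0] by simp
    also have "\<dots> \<le> A * exp 1 + A"
      using y A(1) by (simp add: mult_left_le)
    finally show "norm (bessel_entire y z) \<le> A * exp 1 + A" .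
    show "norm (bessel_entire y z - rGamma (z + 1)) \<le> (A * exp 1 + A) * norm y"
      using tail[OF y z] A(1) by (simp add: distrib_right add_increasing2)
  qed
qed

text \<open>Normalized form of \<open>J_{-n} = (-1)^n J_n\<close> and \<open>I_{-n} = I_n\<close>:
  the first \<open>n\<close> terms vanish at the zeros of the reciprocal Gamma function, and
  shifting the index produces \<open>y^n\<close>.\<close>

lemma bessel_entire_minus_nat:
  "bessel_entire y (- of_nat n) = y ^ n * bessel_entire y (of_nat n)"
proof -
  let ?f = "\<lambda>k. y ^ k / fact k * rGamma (of_nat k + (- of_nat n) + 1)"
  have sum: "summable ?f" by (rule summable_norm_cancel[OF summable_bessel_entire])
  have rG: "rGamma (of_nat k + 1) = inverse (fact k :: complex)" for k
    by (simp add: rGamma_inverse_Gamma Gamma_fact add.commute)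
  have zero: "(\<Sum>k<n. ?f k) = 0"
  proof (rule sum.neutral, rule ballI)
    fix k assume "k \<in> {..<n}"
    then have "of_nat k + (- of_nat n) + 1 = (- of_nat (n - Suc k) :: complex)"
      by (simp add: of_nat_diff)
    then show "?f k = 0"
      by (simp add: rGamma_nonpos_Int)
  qed
  have "bessel_entire y (- of_nat n) = (\<Sum>k. ?f (k + n))"
    unfolding bessel_entire_def using suminf_split_initial_segment[OF sum, of n] zero by simp
  also have "(\<lambda>k. ?f (k + n)) = (\<lambda>k. y ^ n * (y ^ k / fact k * rGamma (of_nat k + of_nat n + 1)))"
  proof
    fix k
    have "rGamma (of_nat k + of_nat n + 1) = inverse (fact (k + n) :: complex)"
      using rG[of "k + n"] by simp
    then show "?f (k + n) = y ^ n * (y ^ k / fact k * rGamma (of_nat k + of_nat n + 1))"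
      using rG[of k] by (simp add: power_add field_simps)
  qed
  also have "suminf \<dots> = y ^ n * bessel_entire y (of_nat n)"
    unfolding bessel_entire_def
    by (rule suminf_mult[OF summable_norm_cancel[OF summable_bessel_entire]])
  finally show ?thesis .
qed

lemma bessel_series_eq:
  fixes x \<mu> s :: real
  assumes "x > 0"
  shows "of_real (\<Sum>k. s ^ k / fact k * rGamma (real k + \<mu> + 1) * x powr (2 * real k + \<mu>)) =
         exp (of_real \<mu> * of_real (ln x)) * bessel_entire (of_real (s * x\<^sup>2)) (of_real \<mu>)"
proof -
  let ?y = "complex_of_real (s * x\<^sup>2)"
  let ?f = "\<lambda>k. ?y ^ k / fact k * rGamma (of_nat k + of_real \<mu> + 1)"
  let ?g = "\<lambda>k. s ^ k / fact k * rGamma (real k + \<mu> + 1) * x powr (2 * real k + \<mu>)"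
  have eq: "of_real (?g k) = exp (of_real \<mu> * of_real (ln x)) * ?f k" for k
  proof -
    have "x powr (2 * real k + \<mu>) = x powr \<mu> * (x\<^sup>2) ^ k"
      using assms powr_realpow[of x "2 * k"] by (simp add: powr_add power_mult)
    moreover have "complex_of_real (x powr \<mu>) = exp (of_real \<mu> * of_real (ln x))"
      using assms by (simp add: powr_def flip: exp_of_real)
    moreover have "complex_of_real (rGamma (real k + \<mu> + 1)) = rGamma (of_nat k + of_real \<mu> + 1)"
      by (simp flip: rGamma_complex_of_real)
    ultimately show ?thesis
      by (simp add: power_mult_distrib)
  qed
  have sum: "summable ?f" by (rule summable_norm_cancel[OF summable_bessel_entire])
  have "(\<lambda>k. complex_of_real (?g k)) sums (exp (of_real \<mu> * of_real (ln x)) * bessel_entire ?y (of_real \<mu>))"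
    unfolding eq bessel_entire_def by (intro sums_mult summable_sums sum)
  note complex_sums = this
  \<comment> \<open>Real parts of the convergent complex series show that the real series converges,
    so \<open>suminf ?g\<close> is its true sum.\<close>
  from sums_Re[OF this] have "?g sums suminf ?g" by (simp only: Re_complex_of_real sums_iff)
  then have "(\<lambda>k. complex_of_real (?g k)) sums of_real (suminf ?g)" by (rule sums_of_real)
  from sums_unique2[OF this complex_sums] show ?thesis .
qed

section \<open>Entire functions with zeros at the integers\<close>

text \<open>Schwarz's lemma after an affine change of variable; on the boundary circle the bound
  \<open>B\<close> alone suffices.\<close>

lemma schwarz_ball:
  fixes H :: "complex \<Rightarrow> complex"
  assumes hol: "H holomorphic_on UNIV" and "H a = 0" and "r > 0"
    and le: "\<And>z. z \<in> cball a r \<Longrightarrow> norm (H z) \<le> B" and z: "z \<in> cball a r"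
  shows "norm (H z) \<le> B / r * norm (z - a)"
proof (cases "norm (z - a) = r")
  case True
  then show ?thesis using le[OF z] \<open>r > 0\<close> by simp
next
  case False
  with z have lt: "norm (z - a) < r" by (simp add: dist_norm norm_minus_commute)
  have B0: "B \<ge> 0" using le[OF z] norm_ge_zero order_trans by blast
  \<comment> \<open>The unit disc version needs a strict bound by 1, hence the division by any
    \<open>C > B\<close>; letting \<open>C\<close> decrease to \<open>B\<close> restores the
    constant.\<close>
  have *: "norm (H z) \<le> C / r * norm (z - a)" if "C > B" for C
  proof -
    define f where "f w = H (a + of_real r * w) / of_real C" for w
    have "C > 0" using that B0 by simp
    have "H \<circ> (\<lambda>w. a + of_real r * w) holomorphic_on ball 0 1"
      by (rule holomorphic_on_compose_gen[OF _ hol]) (auto intro!: holomorphic_intros)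
    then have "f holomorphic_on ball 0 1"
      unfolding f_def o_def using \<open>C > 0\<close> by (intro holomorphic_intros) auto
    moreover have "f 0 = 0" by (simp add: f_def \<open>H a = 0\<close>)
    moreover have "norm (f w) < 1" if "norm w < 1" for w
    proof -
      have "a + of_real r * w \<in> cball a r"
        using that \<open>r > 0\<close> by (simp add: dist_norm norm_mult)
      from le[OF this] show ?thesis
        using \<open>C > 0\<close> \<open>C > B\<close> by (simp add: f_def norm_divide)
    qed
    moreover have "norm ((z - a) / of_real r) < 1"
      using lt \<open>r > 0\<close> by (simp add: norm_divide)
    ultimately have "norm (f ((z - a) / of_real r)) \<le> norm ((z - a) / of_real r)"
      by (rule Schwarz_Lemma(1))
    then show ?thesis
      using \<open>r > 0\<close> \<open>C > 0\<close> by (simp add: f_def norm_divide field_simps)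
  qed
  show ?thesis
  proof (rule tendsto_lowerbound)
    show "((\<lambda>C. C / r * norm (z - a)) \<longlongrightarrow> B / r * norm (z - a)) (at_right B)"
      by (intro tendsto_intros) (use \<open>r > 0\<close> in auto)
    show "\<forall>\<^sub>F C in at_right B. norm (H z) \<le> C / r * norm (z - a)"
      using * by (auto simp: eventually_at_filter)
  qed auto
qed

text \<open>Jordan's inequality: by concavity the sine lies above its chord on
  \<open>[0, pi/2]\<close>. Translation by \<open>n * pi\<close> changes at most the sign.\<close>

lemma abs_sin_pi_ge:
  fixes \<mu> :: real and n :: nat
  assumes "\<bar>\<mu> - real n\<bar> \<le> 1 / 2"
  shows "2 * \<bar>\<mu> - real n\<bar> \<le> \<bar>sin (\<mu> * pi)\<bar>"
proof -
  have jordan: "2 * u \<le> sin (u * pi)" if "0 \<le> u" "u \<le> 1/2" for u :: real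
  proof -
    have "concave_on {0..pi} sin"
      by (rule f''_le0_imp_concave[where f' = cos and f'' = "\<lambda>x. - sin x"])
         (auto intro!: derivative_eq_intros simp: sin_ge_zero)
    from concave_onD[OF this, of "2 * u" 0 "pi/2"] that show ?thesis
      by (simp add: mult_ac)
  qed
  define u where "u = \<mu> - real n"
  have "\<bar>sin (\<mu> * pi)\<bar> = \<bar>sin (u * pi)\<bar>"
    by (simp add: u_def left_diff_distrib sin_diff abs_mult)
  also have "\<dots> \<ge> 2 * \<bar>u\<bar>"
    using jordan[of u] jordan[of "-u"] assms unfolding u_def[symmetric] by (cases "u \<ge> 0") auto
  finally show ?thesis by (simp add: u_def)
qed

lemma bounded_on_cball_of_holomorphic:
  fixes f :: "complex \<Rightarrow> complex"
  assumes "f holomorphic_on UNIV"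
  obtains B where "B > 0" and "\<And>z. norm z \<le> M \<Longrightarrow> norm (f z) \<le> B"
proof -
  have "bounded (f ` cball 0 M)"
    using assms by (intro compact_imp_bounded compact_continuous_image holomorphic_on_imp_continuous_on)
      (auto elim: holomorphic_on_subset)
  then show thesis using that by (auto simp: bounded_pos)
qed

lemma nearest_nat:
  fixes \<mu> :: real
  assumes "\<mu> \<ge> 0"
  obtains n :: nat where "\<bar>\<mu> - real n\<bar> \<le> 1 / 2"
proof -
  have "round \<mu> \<ge> 0" using assms by (metis round_0 round_mono)
  then have "\<bar>\<mu> - real (nat (round \<mu>))\<bar> \<le> 1 / 2"
    using of_int_round_abs_le[of \<mu>] by (simp add: abs_minus_commute)
  then show thesis by (rule that)
qed

text \<open>The factor \<open>1 / (1/2)\<close> from Schwarz's lemma matches the 2 in Jordan's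
  inequality, so a bound on the disc passes to the quotient by the sine without loss. This controls
  the removable singularities at integer orders.\<close>

lemma abs_Re_le_sin_pi:
  fixes H :: "complex \<Rightarrow> complex" and \<mu> :: real
  assumes "H holomorphic_on UNIV" and "H (of_nat n) = 0"
    and le: "\<And>z. z \<in> cball (of_nat n) (1 / 2) \<Longrightarrow> norm (H z) \<le> B"
    and \<mu>: "\<bar>\<mu> - real n\<bar> \<le> 1 / 2"
  shows "\<bar>Re (H (of_real \<mu>))\<bar> \<le> B * \<bar>sin (\<mu> * pi)\<bar>"
proof -
  have eq: "norm (of_real \<mu> - of_nat n :: complex) = \<bar>\<mu> - real n\<bar>"
    by (metis norm_of_real of_real_diff of_real_of_nat_eq)
  then have in_cball: "of_real \<mu> \<in> cball (of_nat n :: complex) (1/2)"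
    using \<mu> by (simp add: dist_norm norm_minus_commute)
  have "0 \<le> B"
    using le[OF in_cball] norm_ge_zero order_trans by blast
  have "\<bar>Re (H (of_real \<mu>))\<bar> \<le> norm (H (of_real \<mu>))" by (rule abs_Re_le_cmod)
  also have "\<dots> \<le> B / (1/2) * norm (of_real \<mu> - of_nat n :: complex)"
    by (rule schwarz_ball[OF assms(1,2) _ le in_cball]) auto
  also have "\<dots> = B * (2 * \<bar>\<mu> - real n\<bar>)" by (simp add: eq)
  also have "\<dots> \<le> B * \<bar>sin (\<mu> * pi)\<bar>"
    by (intro mult_left_mono abs_sin_pi_ge \<mu> \<open>0 \<le> B\<close>)
  finally show ?thesis .
qed

text \<open>Euler's reflection formula, solved for the factor of the leading term
  \<open>x^(-\<mu>) * rGamma (1 - \<mu>)\<close>: the sine to be divided by appears explicitly and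
  cancels.\<close>

lemma rGamma_one_minus:
  fixes \<mu> :: real
  assumes "\<mu> > 0"
  shows "rGamma (1 - \<mu>) = sin (\<mu> * pi) * Gamma \<mu> / pi"
proof -
  have "complex_of_real (rGamma \<mu> * rGamma (1 - \<mu>)) = of_real (sin (pi * \<mu>) / pi)"
    using rGamma_reflection_complex[of "of_real \<mu>"]
    by (simp flip: sin_of_real rGamma_complex_of_real)
  then have "rGamma \<mu> * rGamma (1 - \<mu>) = sin (pi * \<mu>) / pi"
    unfolding of_real_eq_iff .
  moreover have "Gamma \<mu> > 0" using assms by simp
  ultimately show ?thesis by (simp add: rGamma_inverse_Gamma[of \<mu>] field_simps)
qed

section \<open>Uniform divergence at small arguments\<close>

text \<open>
  Here \<open>s = 1\<close>, \<open>c = 1\<close> gives \<open>2 / \<pi> \<sqdot> K\<close>, and \<open>s = -1\<close>, \<open>c(z) = cos (\<pi> z)\<close> gives \<open>-Y\<close>.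
\<close>

locale bessel_quotient =
  fixes s :: real and c :: "complex \<Rightarrow> complex" and cr :: "real \<Rightarrow> real"
  assumes abs_s: "\<bar>s\<bar> = 1"
    and holomorphic_c: "c holomorphic_on UNIV"
    and c_of_real: "\<And>\<mu>. c (of_real \<mu>) = of_real (cr \<mu>)"
    and cr_le_1: "\<And>\<mu>. cr \<mu> \<le> 1"
    and c_nat: "\<And>n. c (of_nat n) = of_real (s ^ n)"
begin

text \<open>Powers of \<open>x\<close> are written as exponentials to be entire in \<open>z\<close>.
  At \<open>x = t / 2\<close> and real \<open>z\<close> the two instances are
  \<open>J_{-z}(t) - cos(z pi) J_z(t)\<close> and \<open>I_{-z}(t) - I_z(t)\<close>.\<close>

definition num :: "real \<Rightarrow> complex \<Rightarrow> complex" where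
  "num x z = exp (- z * of_real (ln x)) * bessel_entire (of_real (s * x\<^sup>2)) (- z)
           - c z * (exp (z * of_real (ln x)) * bessel_entire (of_real (s * x\<^sup>2)) z)"

lemma holomorphic_entire_minus: "(\<lambda>z. bessel_entire y (- z)) holomorphic_on UNIV"
  using holomorphic_on_compose_gen[OF _ holomorphic_bessel_entire, of uminus UNIV]
  by (simp add: o_def holomorphic_on_minus)

lemma holomorphic_num: "num x holomorphic_on UNIV"
  unfolding num_def
  by (intro holomorphic_intros holomorphic_entire_minus holomorphic_bessel_entire holomorphic_c)

text \<open>Since \<open>x^(-n) (s x^2)^n = s^n x^n\<close>, the two terms coincide at
  \<open>n\<close>, where \<open>c\<close> takes the value \<open>s^n\<close>.\<close>

lemma num_nat:
  assumes "x > 0"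
  shows "num x (of_nat n) = 0"
proof -
  have e: "exp (of_nat n * complex_of_real (ln x)) = of_real (x ^ n)"
    using assms by (simp add: exp_of_nat_mult exp_of_real)
  have "exp (- (of_nat n * complex_of_real (ln x))) = inverse (of_real (x ^ n))"
    by (simp only: exp_minus e)
  then show ?thesis
    unfolding num_def using assms
    by (simp add: e bessel_entire_minus_nat c_nat field_simps power_mult_distrib power2_eq_square)
qed

lemma norm_y: "norm (complex_of_real (s * x\<^sup>2)) = x\<^sup>2"
  using abs_s by (simp add: norm_mult norm_power)

lemma quotient_bounded:
  assumes "x > 0"
  obtains B where "\<And>\<mu>. 0 \<le> \<mu> \<Longrightarrow> \<mu> \<le> M \<Longrightarrow> \<mu> \<notin> \<int> \<Longrightarrow> \<bar>Re (num x (of_real \<mu>)) / sin (\<mu> * pi)\<bar> \<le> B"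
proof -
  \<comment> \<open>The disc of radius 1/2 about the integer nearest to \<open>\<mu> \<le> M\<close>
    lies within radius \<open>M + 1\<close> of 0. Here \<open>B\<close> may depend on
    \<open>x\<close>.\<close>
  obtain B where "B > 0" and B: "\<And>z. norm z \<le> M + 1 \<Longrightarrow> norm (num x z) \<le> B"
    using bounded_on_cball_of_holomorphic[OF holomorphic_num, where M = "M + 1"] by metis
  have "\<bar>Re (num x (of_real \<mu>)) / sin (\<mu> * pi)\<bar> \<le> B" if \<mu>: "0 \<le> \<mu>" "\<mu> \<le> M" "\<mu> \<notin> \<int>" for \<mu>
  proof -
    obtain n :: nat where n: "\<bar>\<mu> - real n\<bar> \<le> 1 / 2" using nearest_nat[OF \<mu>(1)] .
    have "\<bar>Re (num x (of_real \<mu>))\<bar> \<le> B * \<bar>sin (\<mu> * pi)\<bar>"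
    proof (rule abs_Re_le_sin_pi[OF holomorphic_num num_nat[OF assms] B n])
      fix z :: complex assume "z \<in> cball (of_nat n) (1 / 2)"
      then have "norm (z - of_nat n) \<le> 1/2" by (simp add: dist_norm norm_minus_commute)
      then have "norm z \<le> real n + 1/2"
        using norm_triangle_ineq2[of z "of_nat n"] by simp
      then show "norm z \<le> M + 1" using n \<mu> by linarith
    qed
    then show ?thesis
      by (cases "sin (\<mu> * pi) = 0") (use \<open>B > 0\<close> in \<open>simp_all add: abs_divide field_simps\<close>)
  qed
  then show thesis by (rule that)
qed

section \<open>Lower bounds near a single integer order\<close>

lemma Re_num_lead:
  "Re (exp (- of_real \<mu> * of_real (ln x)) * rGamma (1 - of_real \<mu>)) = exp (- \<mu> * ln x) * rGamma (1 - \<mu>)"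
proof -
  have "exp (- of_real \<mu> * of_real (ln x)) * rGamma (1 - of_real \<mu>) = complex_of_real (exp (- \<mu> * ln x) * rGamma (1 - \<mu>))"
    by (simp flip: exp_of_real rGamma_complex_of_real)
  then show ?thesis by (simp only: Re_complex_of_real)
qed

lemma norm_exp_le:
  assumes "0 < x" "x \<le> 1" "b \<le> Re z"
  shows "norm (exp (z * of_real (ln x))) \<le> x powr b"
proof -
  have "ln x \<le> 0" using assms by simp
  then have "Re z * ln x \<le> b * ln x" using assms(3) by (intro mult_right_mono_neg)
  then show ?thesis using assms(1) by (simp add: powr_def)
qed

text \<open>For \<open>n \<ge> 1\<close> the leading term \<open>x^(-z) rGamma (1 - z)\<close>
  itself vanishes at \<open>n\<close>, so the remainder \<open>H\<close> does too and can be divided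
  by the sine. On the disc \<open>H\<close> is of order \<open>x^(-n-1/2) x^2 = x^(3/2-n)\<close>,
  one power of \<open>x\<close> better than the lower bound \<open>x^(1/2-n)\<close> for the main
  power.\<close>

lemma lower_bound_away_from_0:
  obtains C where "C > 0" and
    "\<And>x n \<mu>. 0 < x \<Longrightarrow> x \<le> 1 \<Longrightarrow> 1 \<le> n \<Longrightarrow> n \<le> N \<Longrightarrow> \<bar>\<mu> - real n\<bar> \<le> 1/2 \<Longrightarrow> \<mu> \<notin> \<int> \<Longrightarrow>
       x powr (- \<mu>) * Gamma \<mu> / pi - C * x powr (3/2 - real n) \<le> Re (num x (of_real \<mu>)) / sin (\<mu> * pi)"
proof -
  define M where "M = real N + 1"
  obtain A where A: "A > 0"
    "\<And>y z. norm y \<le> 1 \<Longrightarrow> norm z \<le> M \<Longrightarrow> norm (bessel_entire y z) \<le> A"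
    "\<And>y z. norm y \<le> 1 \<Longrightarrow> norm z \<le> M \<Longrightarrow> norm (bessel_entire y z - rGamma (z + 1)) \<le> A * norm y"
    using bessel_entire_bounds[of M] by metis
  obtain D where D: "D > 0" "\<And>z. norm z \<le> M \<Longrightarrow> norm (c z) \<le> D"
    using bounded_on_cball_of_holomorphic[OF holomorphic_c, where M = M] by metis
  define C where "C = A + D * A"
  have "C > 0" using A(1) D(1) by (simp add: C_def add_pos_pos)
  have "x powr (- \<mu>) * Gamma \<mu> / pi - C * x powr (3/2 - real n) \<le> Re (num x (of_real \<mu>)) / sin (\<mu> * pi)"
    if x: "0 < x" "x \<le> 1" and n: "1 \<le> n" "n \<le> N" and \<mu>: "\<bar>\<mu> - real n\<bar> \<le> 1/2" "\<mu> \<notin> \<int>" for x n \<mu>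
  proof -
    define y where "y = complex_of_real (s * x\<^sup>2)"
    have ny: "norm y = x\<^sup>2" unfolding y_def by (rule norm_y)
    have ny1: "norm y \<le> 1" using x by (simp add: ny power_le_one)
    define H where "H z = num x z - exp (- z * of_real (ln x)) * rGamma (1 - z)" for z
    have "\<bar>Re (H (of_real \<mu>))\<bar> \<le> C * x powr (3/2 - real n) * \<bar>sin (\<mu> * pi)\<bar>"
    proof (rule abs_Re_le_sin_pi[OF _ _ _ \<mu>(1)])
      show "H holomorphic_on UNIV"
        unfolding H_def by (intro holomorphic_intros holomorphic_num)
      have "1 - of_nat n = (- of_nat (n - 1) :: complex)"
        using n(1) by (simp add: of_nat_diff)
      then have "rGamma (1 - of_nat n :: complex) = 0"
        by (simp add: rGamma_nonpos_Int)
      then show "H (of_nat n) = 0" by (simp add: H_def num_nat[OF x(1)])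
      fix z :: complex assume "z \<in> cball (of_nat n) (1 / 2)"
      then have z: "norm (z - of_nat n) \<le> 1/2" by (simp add: dist_norm norm_minus_commute)
      then have "norm z \<le> real n + 1/2"
        using norm_triangle_ineq2[of z "of_nat n"] by simp
      then have zM: "norm z \<le> M" using n by (simp add: M_def)
      have "\<bar>Re z - real n\<bar> \<le> 1/2" using abs_Re_le_cmod[of "z - of_nat n"] z by simp
      then have Re_z: "real n - 1/2 \<le> Re z" "- (real n + 1/2) \<le> Re (- z)" by (simp_all, linarith+)
      have "norm (exp (- z * of_real (ln x)) * (bessel_entire y (- z) - rGamma (- z + 1)))
          \<le> x powr (- (real n + 1/2)) * (A * x\<^sup>2)"
        unfolding norm_mult using A(3)[OF ny1, of "- z"] zM
        by (intro mult_mono norm_exp_le[OF x Re_z(2)]) (simp_all add: ny)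
      also have "\<dots> = A * x powr (3/2 - real n)"
      proof -
        have "x\<^sup>2 = x powr 2" using x by simp
        then have "x powr (- (real n + 1/2)) * x\<^sup>2 = x powr (- (real n + 1/2) + 2)"
          by (simp only: powr_add)
        then show ?thesis by (simp add: algebra_simps)
      qed
      finally have 1: "norm (exp (- z * of_real (ln x)) * (bessel_entire y (- z) - rGamma (- z + 1)))
          \<le> A * x powr (3/2 - real n)" .
      \<comment> \<open>The term with \<open>x^z\<close> is absorbed into the same order:
        \<open>3/2 - n \<le> n - 1/2\<close> because \<open>n \<ge> 1\<close>.\<close>
      have "x powr (real n - 1/2) \<le> x powr (3/2 - real n)"
        using x n by (intro powr_mono') auto
      then have "norm (exp (z * of_real (ln x))) \<le> x powr (3/2 - real n)"
        using norm_exp_le[OF x Re_z(1)] by linarith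
      then have 2: "norm (c z * (exp (z * of_real (ln x)) * bessel_entire y z))
          \<le> D * (x powr (3/2 - real n) * A)"
        unfolding norm_mult using D A(1) A(2)[OF ny1 zM] zM by (intro mult_mono) auto
      have "H z = exp (- z * of_real (ln x)) * (bessel_entire y (- z) - rGamma (- z + 1))
          - c z * (exp (z * of_real (ln x)) * bessel_entire y z)"
        by (simp add: H_def num_def y_def algebra_simps)
      also have "norm \<dots> \<le> A * x powr (3/2 - real n) + D * (x powr (3/2 - real n) * A)"
        by (intro order_trans[OF norm_triangle_ineq4] add_mono 1 2)
      also have "\<dots> = C * x powr (3/2 - real n)" by (simp add: C_def algebra_simps)
      finally show "norm (H z) \<le> C * x powr (3/2 - real n)" .
    qed
    moreover have "sin (\<mu> * pi) \<noteq> 0" using \<mu>(2)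
      by (metis sin_zero_iff_int2 Ints_of_int mult_right_cancel pi_neq_zero)
    ultimately have le: "\<bar>Re (H (of_real \<mu>)) / sin (\<mu> * pi)\<bar> \<le> C * x powr (3/2 - real n)"
      by (simp add: abs_divide field_simps)
    have "\<mu> > 0" using \<mu> n by linarith
    have "Re (num x (of_real \<mu>)) = Re (H (of_real \<mu>)) + exp (- \<mu> * ln x) * rGamma (1 - \<mu>)"
      by (simp only: H_def minus_complex.sel Re_num_lead)
    also have "\<dots> = Re (H (of_real \<mu>)) + x powr (- \<mu>) * Gamma \<mu> / pi * sin (\<mu> * pi)"
      using x(1) rGamma_one_minus[OF \<open>\<mu> > 0\<close>] by (simp add: powr_def)
    finally have "Re (num x (of_real \<mu>)) / sin (\<mu> * pi)
        = Re (H (of_real \<mu>)) / sin (\<mu> * pi) + x powr (- \<mu>) * Gamma \<mu> / pi"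
      using \<open>sin (\<mu> * pi) \<noteq> 0\<close> by (simp add: add_divide_distrib)
    with le show ?thesis by linarith
  qed
  with \<open>C > 0\<close> show thesis by (rule that)
qed

text \<open>At order 0 neither leading term vanishes, only their difference does, so both are
  subtracted together. With \<open>L = - ln x\<close>, that difference is at least
  \<open>\<mu> (r L - 2 E)\<close>, and division by \<open>sin (\<mu> pi) \<le> \<mu> pi\<close>
  leaves logarithmic growth.\<close>

lemma lower_bound_near_0:
  obtains r C where "r > 0" and
    "\<And>x \<mu>. 0 < x \<Longrightarrow> x \<le> 1 \<Longrightarrow> C \<le> r * - ln x \<Longrightarrow> 0 < \<mu> \<Longrightarrow> \<mu> \<le> 1/2 \<Longrightarrow>
       r * - ln x - C \<le> Re (num x (of_real \<mu>)) / sin (\<mu> * pi)"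
proof -
  obtain A where A: "A > 0"
    "\<And>y z. norm y \<le> 1 \<Longrightarrow> norm z \<le> 1 \<Longrightarrow> norm (bessel_entire y z - rGamma (z + 1)) \<le> A * norm y"
    using bessel_entire_bounds[of 1] by metis
  obtain D where D: "D > 0" "\<And>z. norm z \<le> 1 \<Longrightarrow> norm (c z) \<le> D"
    using bounded_on_cball_of_holomorphic[OF holomorphic_c, where M = 1] by metis
  \<comment> \<open>\<open>G\<close> vanishes at 0, so by Schwarz's lemma exchanging
    \<open>rGamma (1 + \<mu>)\<close> for \<open>rGamma (1 - \<mu>)\<close> costs only
    \<open>2 * E * \<mu>\<close>.\<close>
  define G where "G z = rGamma (1 + z) - rGamma (1 - z)" for z :: complex
  have hol_G: "G holomorphic_on UNIV" unfolding G_def by (intro holomorphic_intros)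
  obtain E where E: "E > 0" "\<And>z. norm z \<le> 1 \<Longrightarrow> norm (G z) \<le> E"
    using bounded_on_cball_of_holomorphic[OF hol_G, where M = 1] by metis
  have "\<exists>\<mu>0\<in>{0..1/2}. \<forall>\<mu>\<in>{0..1/2}. rGamma (1 - \<mu>0) \<le> (rGamma (1 - \<mu>) :: real)"
    by (rule continuous_attains_inf)
      (auto intro!: continuous_on_compose2[OF continuous_on_rGamma] continuous_intros)
  then obtain \<mu>0 :: real where \<mu>0: "\<mu>0 \<in> {0..1/2}" "\<And>\<mu>. 0 \<le> \<mu> \<Longrightarrow> \<mu> \<le> 1/2 \<Longrightarrow> rGamma (1 - \<mu>0) \<le> rGamma (1 - \<mu>)"
    by auto
  define r where "r = rGamma (1 - \<mu>0)"
  have "r > 0" using \<mu>0(1) by (simp add: r_def rGamma_inverse_Gamma)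
  define B where "B = A + D * A"
  define C where "C = B * pi + 2 * E"
  have "(r * - ln x - 2 * E) / pi - B \<le> Re (num x (of_real \<mu>)) / sin (\<mu> * pi)"
    if x: "0 < x" "x \<le> 1" and xr: "2 * E \<le> r * - ln x" and \<mu>: "0 < \<mu>" "\<mu> \<le> 1/2" for x \<mu>
  proof -
    define y where "y = complex_of_real (s * x\<^sup>2)"
    have ny: "norm y = x\<^sup>2" unfolding y_def by (rule norm_y)
    have ny1: "norm y \<le> 1" using x by (simp add: ny power_le_one)
    define H where "H z = num x z - (exp (- z * of_real (ln x)) * rGamma (1 - z)
        - c z * (exp (z * of_real (ln x)) * rGamma (1 + z)))" for z
    have \<mu>0': "\<bar>\<mu> - real 0\<bar> \<le> 1/2" using \<mu> by simp
    have bd: "\<bar>Re (H (of_real \<mu>))\<bar> \<le> B * \<bar>sin (\<mu> * pi)\<bar>"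
    proof (rule abs_Re_le_sin_pi[OF _ _ _ \<mu>0'])
      show "H holomorphic_on UNIV"
        unfolding H_def by (intro holomorphic_intros holomorphic_num holomorphic_c)
      show "H (of_nat 0) = 0" using num_nat[OF x(1), of 0] c_nat[of 0] by (simp add: H_def)
      fix z :: complex assume "z \<in> cball (of_nat 0) (1 / 2)"
      then have z: "norm z \<le> 1/2" by simp
      have Re_z: "- (1/2) \<le> Re z" "- (1/2) \<le> Re (- z)"
        using abs_Re_le_cmod[of z] z by (simp_all add: abs_le_iff)
      have small: "norm (exp (w * of_real (ln x)) * (bessel_entire y w - rGamma (w + 1))) \<le> A"
        if "- (1/2) \<le> Re w" "norm w \<le> 1/2" for w
      proof -
        have "norm (exp (w * of_real (ln x)) * (bessel_entire y w - rGamma (w + 1)))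
            \<le> x powr (- (1/2)) * (A * x\<^sup>2)"
          unfolding norm_mult using A(2)[OF ny1, of w] that
          by (intro mult_mono norm_exp_le[OF x that(1)]) (simp_all add: ny)
        also have "\<dots> = A * (x powr (- (1/2)) * x powr 2)" using x by simp
        also have "\<dots> = A * x powr (3/2)" by (simp flip: powr_add)
        also have "\<dots> \<le> A" using A(1) x by (simp add: mult_left_le powr_le1)
        finally show ?thesis .
      qed
      have 1: "norm (exp (- z * of_real (ln x)) * (bessel_entire y (- z) - rGamma (- z + 1))) \<le> A"
        using small[OF Re_z(2)] z by simp
      have 2: "norm (c z * (exp (z * of_real (ln x)) * (bessel_entire y z - rGamma (z + 1)))) \<le> D * A"
        unfolding norm_mult[of "c z"] using small[OF Re_z(1) z] D(1) D(2)[of z] z by (intro mult_mono) auto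
      have "H z = exp (- z * of_real (ln x)) * (bessel_entire y (- z) - rGamma (- z + 1))
          - c z * (exp (z * of_real (ln x)) * (bessel_entire y z - rGamma (z + 1)))"
        by (simp add: H_def num_def y_def algebra_simps)
      also have "norm \<dots> \<le> A + D * A"
        by (intro order_trans[OF norm_triangle_ineq4] add_mono 1 2)
      finally show "norm (H z) \<le> B" by (simp add: B_def)
    qed
    have spos: "sin (\<mu> * pi) > 0" using \<mu> by (intro sin_gt_zero) auto
    have sle: "sin (\<mu> * pi) \<le> \<mu> * pi" using \<mu> by (intro sin_x_le_x) auto
    have ReH: "Re (H (of_real \<mu>)) / sin (\<mu> * pi) \<ge> - B"
      using bd spos by (simp add: field_simps abs_le_iff)
    define L where "L = - ln x"
    have L0: "L \<ge> 0" using x by (simp add: L_def)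
    have Gle: "rGamma (1 + \<mu>) - rGamma (1 - \<mu>) \<le> 2 * E * \<mu>"
    proof -
      have "norm (G (of_real \<mu>)) \<le> E / (1/2) * norm (of_real \<mu> - 0 :: complex)"
        by (rule schwarz_ball[OF hol_G]) (use \<mu> E in \<open>auto simp: G_def\<close>)
      moreover have "G (of_real \<mu>) = of_real (rGamma (1 + \<mu>) - rGamma (1 - \<mu>))"
        unfolding G_def by (simp flip: rGamma_complex_of_real)
      ultimately have "\<bar>rGamma (1 + \<mu>) - rGamma (1 - \<mu>)\<bar> \<le> 2 * E * \<mu>"
        using \<mu> by (simp only: norm_of_real) simp
      then show ?thesis by linarith
    qed
    have rG: "rGamma (1 + \<mu>) \<ge> 0" using \<mu> by (simp add: rGamma_inverse_Gamma less_imp_le)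
    \<comment> \<open>Bound \<open>cr \<mu>\<close> by 1, exchange the Gamma factors, and use
      \<open>exp u - exp (-u) \<ge> u\<close> for \<open>u = \<mu> * L \<ge> 0\<close>.\<close>
    have lead: "\<mu> * (r * L - 2 * E) \<le> exp (\<mu> * L) * rGamma (1 - \<mu>) - cr \<mu> * (exp (- (\<mu> * L)) * rGamma (1 + \<mu>))"
    proof -
      define e where "e = exp (- (\<mu> * L))"
      have e: "0 \<le> e" "e \<le> 1" using \<mu> L0 by (simp_all add: e_def)
      have "cr \<mu> * (e * rGamma (1 + \<mu>)) \<le> 1 * (e * rGamma (1 + \<mu>))"
        using e rG by (intro mult_right_mono cr_le_1) auto
      also have "\<dots> \<le> e * (rGamma (1 - \<mu>) + 2 * E * \<mu>)"
        using Gle e by (simp add: mult_left_mono)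
      also have "\<dots> \<le> e * rGamma (1 - \<mu>) + 2 * E * \<mu>"
        using e E(1) \<mu> by (simp add: distrib_left mult_left_le_one_le)
      finally have 1: "cr \<mu> * (e * rGamma (1 + \<mu>)) \<le> e * rGamma (1 - \<mu>) + 2 * E * \<mu>" .
      have "\<mu> * L * r \<le> (exp (\<mu> * L) - e) * rGamma (1 - \<mu>)"
      proof (rule mult_mono)
        show "\<mu> * L \<le> exp (\<mu> * L) - e" using exp_ge_add_one_self[of "\<mu> * L"] e by linarith
        show "r \<le> rGamma (1 - \<mu>)" unfolding r_def using \<mu> by (intro \<mu>0(2)) auto
        then show "0 \<le> r" using \<open>r > 0\<close> by simp
        show "0 \<le> exp (\<mu> * L) - e" using e \<mu> L0 order_trans[of e 1 "exp (\<mu> * L)"] by simp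
      qed
      with 1 show ?thesis unfolding e_def[symmetric] by (simp add: algebra_simps)
    qed
    have "(r * L - 2 * E) / pi \<le> (r * L - 2 * E) * \<mu> / sin (\<mu> * pi)"
    proof -
      \<comment> \<open>The assumed size of \<open>- ln x\<close> makes \<open>r * L - 2 * E\<close>
        nonnegative, which fixes the direction of this estimate.\<close>
      have "(r * L - 2 * E) * sin (\<mu> * pi) \<le> (r * L - 2 * E) * (\<mu> * pi)"
        using sle xr by (intro mult_left_mono) (auto simp: L_def)
      then show ?thesis using spos by (simp add: field_simps)
    qed
    also have "\<dots> \<le> (exp (\<mu> * L) * rGamma (1 - \<mu>) - cr \<mu> * (exp (- (\<mu> * L)) * rGamma (1 + \<mu>))) / sin (\<mu> * pi)"
      using lead spos by (intro divide_right_mono) (auto simp: mult_ac)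
    finally have main: "(r * L - 2 * E) / pi \<le> \<dots>" .
    have "c (of_real \<mu>) * (exp (of_real \<mu> * of_real (ln x)) * rGamma (1 + of_real \<mu>))
        = complex_of_real (cr \<mu> * (exp (\<mu> * ln x) * rGamma (1 + \<mu>)))"
      unfolding c_of_real by (simp flip: exp_of_real rGamma_complex_of_real)
    then have "Re (num x (of_real \<mu>)) = Re (H (of_real \<mu>))
        + (exp (\<mu> * L) * rGamma (1 - \<mu>) - cr \<mu> * (exp (- (\<mu> * L)) * rGamma (1 + \<mu>)))"
      by (simp only: H_def minus_complex.sel Re_num_lead Re_complex_of_real) (simp add: L_def)
    then have "Re (num x (of_real \<mu>)) / sin (\<mu> * pi) = Re (H (of_real \<mu>)) / sin (\<mu> * pi)
        + (exp (\<mu> * L) * rGamma (1 - \<mu>) - cr \<mu> * (exp (- (\<mu> * L)) * rGamma (1 + \<mu>))) / sin (\<mu> * pi)"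
      by (simp add: add_divide_distrib)
    with ReH main show ?thesis by (simp add: L_def)
  qed
  note bound = this
  show thesis
  proof (rule that[of "r / pi" "2 * E / pi + B"])
    show "r / pi > 0" using \<open>r > 0\<close> by simp
    have "B \<ge> 0" using A(1) D(1) by (simp add: B_def)
    fix x \<mu> :: real
    assume *: "0 < x" "x \<le> 1" "2 * E / pi + B \<le> r / pi * - ln x" "0 < \<mu>" "\<mu> \<le> 1/2"
    then have "2 * E / pi \<le> r * - ln x / pi" using \<open>B \<ge> 0\<close> by simp
    then have "2 * E \<le> r * - ln x" by (simp only: divide_le_cancel) simp
    from bound[OF *(1,2) this *(4,5)]
    show "r / pi * - ln x - (2 * E / pi + B) \<le> Re (num x (of_real \<mu>)) / sin (\<mu> * pi)"
      by (simp add: diff_divide_distrib)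
  qed
qed

end

section \<open>Uniformity over a bounded range of orders\<close>

context bessel_quotient
begin

text \<open>Every order is within 1/2 of some integer \<open>n\<close>, and only finitely many
  \<open>n\<close> occur. For \<open>n = 0\<close> the logarithmic bound applies; for
  \<open>n \<ge> 1\<close> the quotient is at least \<open>x^(1/2-n) (g - C x)\<close>, where
  \<open>g\<close> is a positive lower bound of \<open>Gamma / pi\<close>.\<close>

lemma quotient_at_top_uniformly:
  "\<forall>\<^sub>F x in at_right 0. \<forall>\<mu>. 0 \<le> \<mu> \<longrightarrow> \<mu> \<le> M \<longrightarrow> \<mu> \<notin> \<int> \<longrightarrow>
     K \<le> Re (num x (of_real \<mu>)) / sin (\<mu> * pi)"
proof -
  obtain N :: nat where N: "M + 1/2 \<le> real N" using real_arch_simple by blast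
  obtain C where "C > 0" and C: "\<And>x n \<mu>. 0 < x \<Longrightarrow> x \<le> 1 \<Longrightarrow> 1 \<le> n \<Longrightarrow> n \<le> N \<Longrightarrow> \<bar>\<mu> - real n\<bar> \<le> 1/2 \<Longrightarrow> \<mu> \<notin> \<int> \<Longrightarrow>
       x powr (- \<mu>) * Gamma \<mu> / pi - C * x powr (3/2 - real n) \<le> Re (num x (of_real \<mu>)) / sin (\<mu> * pi)"
    using lower_bound_away_from_0[of N] by metis
  obtain r C' where "r > 0" and C': "\<And>x \<mu>. 0 < x \<Longrightarrow> x \<le> 1 \<Longrightarrow> C' \<le> r * - ln x \<Longrightarrow> 0 < \<mu> \<Longrightarrow> \<mu> \<le> 1/2 \<Longrightarrow>
       r * - ln x - C' \<le> Re (num x (of_real \<mu>)) / sin (\<mu> * pi)"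
    using lower_bound_near_0 by metis
  have "\<exists>\<mu>0\<in>{1/2..real N + 1/2}. \<forall>\<mu>\<in>{1/2..real N + 1/2}. Gamma \<mu>0 \<le> (Gamma \<mu> :: real)"
    by (rule continuous_attains_inf)
      (auto intro!: continuous_intros elim!: nonpos_Ints_cases)
  then obtain \<mu>0 :: real where \<mu>0: "1/2 \<le> \<mu>0" "\<And>\<mu>. 1/2 \<le> \<mu> \<Longrightarrow> \<mu> \<le> real N + 1/2 \<Longrightarrow> Gamma \<mu>0 \<le> Gamma \<mu>"
    by auto
  define g where "g = Gamma \<mu>0 / pi"
  have "g > 0" using \<mu>0(1) by (simp add: g_def)
  have neg_ln: "filterlim (\<lambda>x::real. - ln x) at_top (at_right 0)"
    using ln_at_0 by (simp add: filterlim_uminus_at_bot)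
  have ev: "\<forall>\<^sub>F x in at_right 0. k \<le> - ln x" for k :: real
    using neg_ln by (simp add: filterlim_at_top)
  \<comment> \<open>Below \<open>g / (2 * C)\<close> the error uses up at most half of
    \<open>g\<close>. The thresholds on \<open>- ln x\<close> further down serve
    \<open>n = 0\<close> and \<open>n \<ge> 1\<close> respectively.\<close>
  have "\<forall>\<^sub>F x in at_right (0::real). x < min 1 (g / (2 * C))"
    using \<open>g > 0\<close> \<open>C > 0\<close> by (intro eventually_at_rightI[of 0 "min 1 (g / (2 * C))"]) auto
  moreover have "\<forall>\<^sub>F x in at_right (0::real). 0 < x"
    by (simp add: eventually_at_right_less)
  ultimately show ?thesis
    using ev[of "max (C' / r) ((K + C') / r)"] ev[of "4 * K / g"]
  proof eventually_elim
    case (elim x)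
    have x: "0 < x" "x \<le> 1" using elim by auto
    have r1: "C' \<le> r * - ln x" "K + C' \<le> r * - ln x"
      using elim(3) \<open>r > 0\<close> by (simp_all add: field_simps)
    have Cx: "C * x \<le> g / 2" using elim(1) \<open>C > 0\<close> by (simp add: field_simps)
    have K: "K \<le> g / 2 * (- ln x / 2)" using elim(4) \<open>g > 0\<close> by (simp add: field_simps)
    show ?case
    proof (intro allI impI)
      fix \<mu> :: real assume \<mu>: "0 \<le> \<mu>" "\<mu> \<le> M" "\<mu> \<notin> \<int>"
      then have "\<mu> \<noteq> 0" by auto
      obtain n :: nat where n: "\<bar>\<mu> - real n\<bar> \<le> 1 / 2" using nearest_nat[OF \<mu>(1)] .
      show "K \<le> Re (num x (of_real \<mu>)) / sin (\<mu> * pi)"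
      proof (cases "n = 0")
        case True
        then have "r * - ln x - C' \<le> Re (num x (of_real \<mu>)) / sin (\<mu> * pi)"
          using n \<mu> \<open>\<mu> \<noteq> 0\<close> by (intro C' x r1(1)) auto
        with r1(2) show ?thesis by linarith
      next
        case False
        then have n1: "1 \<le> n" by simp
        have "real n \<le> real N" using n \<mu> N by linarith
        then have nN: "n \<le> N" by simp
        have n1': "1 \<le> real n" using n1 by simp
        have \<mu>n: "real n - 1/2 \<le> \<mu>" "1/2 \<le> \<mu>" "\<mu> \<le> real N + 1/2" using n n1' \<open>real n \<le> real N\<close> by linarith+
        have "x powr (1/2 - real n) * g \<le> x powr (- \<mu>) * (Gamma \<mu> / pi)"
          using \<mu>n x \<open>g > 0\<close> \<mu>0(2)[of \<mu>] by (intro mult_mono powr_mono') (auto simp: g_def divide_right_mono)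
        then have "x powr (1/2 - real n) * g - C * x powr (3/2 - real n) \<le> Re (num x (of_real \<mu>)) / sin (\<mu> * pi)"
          using C[OF x n1 nN n \<mu>(3)] by simp
        moreover have "x powr (3/2 - real n) = x powr (1/2 - real n) * x"
          using x powr_add[of x "1/2 - real n" 1] by simp
        moreover have "x powr (1/2 - real n) * (g / 2) \<le> x powr (1/2 - real n) * (g - C * x)"
          using Cx by (intro mult_left_mono) auto
        ultimately have "x powr (1/2 - real n) * (g / 2) \<le> Re (num x (of_real \<mu>)) / sin (\<mu> * pi)"
          by (simp add: algebra_simps)
        \<comment> \<open>From \<open>u \<le> exp u\<close> at \<open>u = - ln x / 2\<close>, where
          \<open>exp u = x^(-1/2)\<close>; this makes the growth independent of
          \<open>n\<close>.\<close>
        moreover have "- ln x / 2 \<le> x powr (1/2 - real n)"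
        proof -
          have "- ln x / 2 \<le> exp (- (1/2) * ln x)" using exp_ge_add_one_self[of "- (1/2) * ln x"] by simp
          also have "\<dots> = x powr (- (1/2))" using x by (simp add: powr_def)
          also have "\<dots> \<le> x powr (1/2 - real n)" using x n1' by (intro powr_mono') auto
          finally show ?thesis .
        qed
        then have "g / 2 * (- ln x / 2) \<le> x powr (1/2 - real n) * (g / 2)"
          using \<open>g > 0\<close> by (subst mult.commute) (intro mult_right_mono, auto)
        ultimately show ?thesis using K by linarith
      qed
    qed
  qed
qed

lemma continuous_num: "continuous_on UNIV (\<lambda>\<mu>. Re (num x (of_real \<mu>)))"
  by (intro continuous_intros continuous_on_compose2[OF holomorphic_on_imp_continuous_on[OF holomorphic_num]]) auto

lemma quotient_measurable: "(\<lambda>\<mu>. Re (num x (of_real \<mu>)) / sin (\<mu> * pi)) \<in> borel_measurable borel"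
  by (intro borel_measurable_divide borel_measurable_continuous_onI continuous_num continuous_intros)

end

section \<open>Fractional integration in the order\<close>

text \<open>The reflection \<open>u = b - \<mu>\<close> moves the singularity to 0, where the
  exponent \<open>\<alpha> - 1 > -1\<close> is integrable.\<close>

lemma powr_weight_integral:
  fixes \<alpha> a b :: real
  assumes "\<alpha> > 0" and "a \<le> b"
  shows "set_integrable lborel {a..b} (\<lambda>\<mu>. (b - \<mu>) powr (\<alpha> - 1))"
    and "(LBINT \<mu>:{a..b}. (b - \<mu>) powr (\<alpha> - 1)) = (b - a) powr \<alpha> / \<alpha>"
proof -
  have hi: "((\<lambda>u. u powr (\<alpha> - 1)) has_integral ((b - a) powr \<alpha> / \<alpha>)) {0..b - a}"
    using has_integral_powr_from_0[of "\<alpha> - 1" "b - a"] assms by simp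
  then have "(\<lambda>u. u powr (\<alpha> - 1)) absolutely_integrable_on {0..b - a}"
    by (intro nonnegative_absolutely_integrable_1) (auto simp: integrable_on_def)
  then have si: "set_integrable lborel {0..b - a} (\<lambda>u. u powr (\<alpha> - 1))"
    unfolding set_integrable_def by (subst (asm) integrable_completion) auto
  have val: "(LBINT u:{0..b - a}. u powr (\<alpha> - 1)) = (b - a) powr \<alpha> / \<alpha>"
    using set_borel_integral_eq_integral(2)[OF si] hi by (simp add: integral_unique)
  let ?h = "\<lambda>u. indicator {0..b - a} u *\<^sub>R u powr (\<alpha> - 1)"
  have eq: "(\<lambda>\<mu>. ?h (b + (- 1) * \<mu>)) = (\<lambda>\<mu>. indicator {a..b} \<mu> *\<^sub>R (b - \<mu>) powr (\<alpha> - 1))"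
    by (auto simp: indicator_def fun_eq_iff)
  show "set_integrable lborel {a..b} (\<lambda>\<mu>. (b - \<mu>) powr (\<alpha> - 1))"
    using lborel_integrable_real_affine[of ?h "- 1" b] si unfolding eq set_integrable_def by simp
  show "(LBINT \<mu>:{a..b}. (b - \<mu>) powr (\<alpha> - 1)) = (b - a) powr \<alpha> / \<alpha>"
    using lborel_integral_real_affine[of "- 1" ?h b] val unfolding eq set_lebesgue_integral_def by simp
qed

lemma countable_Ints_real: "countable (\<int> :: real set)"
  unfolding Ints_def by simp

text \<open>The factor of \<open>K\<close> is the fractional integral of the constant 1. The bound
  \<open>B\<close> makes the integrand integrable, so that the Lebesgue integral is monotone here
  and not the default 0.\<close>

lemma frac_integral_ge:
  assumes "\<alpha> > 0" and "\<nu>\<^sub>0 < \<nu>"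
    and f: "f \<in> borel_measurable borel"
    and ge: "\<And>\<mu>. \<nu>\<^sub>0 \<le> \<mu> \<Longrightarrow> \<mu> \<le> \<nu> \<Longrightarrow> \<mu> \<notin> \<int> \<Longrightarrow> K \<le> f \<mu>"
    and le: "\<And>\<mu>. \<nu>\<^sub>0 \<le> \<mu> \<Longrightarrow> \<mu> \<le> \<nu> \<Longrightarrow> \<mu> \<notin> \<int> \<Longrightarrow> \<bar>f \<mu>\<bar> \<le> B"
  shows "K * ((\<nu> - \<nu>\<^sub>0) powr \<alpha> / (\<alpha> * Gamma \<alpha>)) \<le> frac_integral \<alpha> \<nu>\<^sub>0 f \<nu>"
proof -
  let ?w = "\<lambda>\<mu>. (\<nu> - \<mu>) powr (\<alpha> - 1)"
  have [measurable]: "f \<in> borel_measurable borel" by (rule f)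
  note w = powr_weight_integral[of \<alpha> \<nu>\<^sub>0 \<nu>]
  have wi: "integrable lborel (\<lambda>\<mu>. indicator {\<nu>\<^sub>0..\<nu>} \<mu> *\<^sub>R ?w \<mu>)"
    using w(1) assms by (simp add: set_integrable_def)
  have AE_nonint: "AE \<mu> in lborel. \<mu> \<notin> (\<int> :: real set)"
    by (intro AE_not_in countable_imp_null_set_lborel countable_Ints_real)
  have fi: "integrable lborel (\<lambda>\<mu>. indicator {\<nu>\<^sub>0..\<nu>} \<mu> *\<^sub>R (?w \<mu> * f \<mu>))"
  proof (rule Bochner_Integration.integrable_bound)
    show "integrable lborel (\<lambda>\<mu>. B * (indicator {\<nu>\<^sub>0..\<nu>} \<mu> *\<^sub>R ?w \<mu>))"
      using wi by (rule integrable_mult_right)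
    show "AE \<mu> in lborel. norm (indicator {\<nu>\<^sub>0..\<nu>} \<mu> *\<^sub>R (?w \<mu> * f \<mu>)) \<le> norm (B * (indicator {\<nu>\<^sub>0..\<nu>} \<mu> *\<^sub>R ?w \<mu>))"
      using AE_nonint
    proof eventually_elim
      case (elim \<mu>)
      show ?case
      proof (cases "\<mu> \<in> {\<nu>\<^sub>0..\<nu>}")
        case True
        then have "\<bar>f \<mu>\<bar> \<le> \<bar>B\<bar>" using le[of \<mu>] elim by auto
        then show ?thesis using True by (simp add: abs_mult mult.commute mult_right_mono)
      qed auto
    qed
  qed measurable
  have "K * (LBINT \<mu>:{\<nu>\<^sub>0..\<nu>}. ?w \<mu>) = (\<integral>\<mu>. K * (indicator {\<nu>\<^sub>0..\<nu>} \<mu> *\<^sub>R ?w \<mu>) \<partial>lborel)"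
    by (simp add: set_lebesgue_integral_def)
  also have "\<dots> \<le> (LBINT \<mu>:{\<nu>\<^sub>0..\<nu>}. ?w \<mu> * f \<mu>)"
    unfolding set_lebesgue_integral_def
  proof (rule integral_mono_AE[OF _ fi])
    show "integrable lborel (\<lambda>\<mu>. K * (indicator {\<nu>\<^sub>0..\<nu>} \<mu> *\<^sub>R ?w \<mu>))"
      using wi by (rule integrable_mult_right)
    show "AE \<mu> in lborel. K * (indicator {\<nu>\<^sub>0..\<nu>} \<mu> *\<^sub>R ?w \<mu>) \<le> indicator {\<nu>\<^sub>0..\<nu>} \<mu> *\<^sub>R (?w \<mu> * f \<mu>)"
      using AE_nonint
    proof eventually_elim
      case (elim \<mu>)
      then show ?case using ge[of \<mu>]
        by (auto simp: indicator_def mult.commute[of K] intro!: mult_left_mono)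
    qed
  qed
  finally have "1 / Gamma \<alpha> * (K * ((\<nu> - \<nu>\<^sub>0) powr \<alpha> / \<alpha>)) \<le> frac_integral \<alpha> \<nu>\<^sub>0 f \<nu>"
    unfolding frac_integral_def using w(2) assms(1,2) by (intro mult_left_mono) auto
  then show ?thesis by (simp add: mult_ac)
qed

lemma frac_integral_uminus: "frac_integral \<alpha> \<nu>\<^sub>0 (\<lambda>\<mu>. - f \<mu>) \<nu> = - frac_integral \<alpha> \<nu>\<^sub>0 f \<nu>"
  by (simp add: frac_integral_def set_lebesgue_integral_def)

text \<open>
  Integer orders form a null set, so the values of \<open>f\<close> there, which are limits with respect to
  the order for the functions of the second kind, play no role.
\<close>

lemma (in bessel_quotient) frac_integral_at_top:
  assumes "\<alpha> > 0" and "0 \<le> \<nu>\<^sub>0" and "\<nu>\<^sub>0 < \<nu>" and "a > 0"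
    and f: "\<And>t \<mu>. t > 0 \<Longrightarrow> \<mu> \<notin> \<int> \<Longrightarrow> f \<mu> t = a * (Re (num (t / 2) (of_real \<mu>)) / sin (\<mu> * pi))"
  shows "filterlim (\<lambda>t. frac_integral \<alpha> \<nu>\<^sub>0 (\<lambda>\<mu>. f \<mu> t) \<nu>) at_top (at_right 0)"
proof -
  define W where "W = (\<nu> - \<nu>\<^sub>0) powr \<alpha> / (\<alpha> * Gamma \<alpha>)"
  have "W > 0" using assms by (simp add: W_def)
  have half: "filterlim (\<lambda>t::real. t / 2) (at_right 0) (at_right 0)"
    unfolding filterlim_at by (auto intro!: tendsto_eq_intros eventually_mono[OF eventually_at_right_less[of 0]])
  show ?thesis
    unfolding filterlim_at_top
  proof
    fix Z :: real
    have "\<forall>\<^sub>F t in at_right 0. \<forall>\<mu>. 0 \<le> \<mu> \<longrightarrow> \<mu> \<le> \<nu> \<longrightarrow> \<mu> \<notin> \<int> \<longrightarrow>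
        Z / W / a \<le> Re (num (t / 2) (of_real \<mu>)) / sin (\<mu> * pi)"
      by (rule eventually_compose_filterlim[OF quotient_at_top_uniformly half])
    moreover have "\<forall>\<^sub>F t in at_right (0::real). 0 < t" by (simp add: eventually_at_right_less)
    ultimately show "\<forall>\<^sub>F t in at_right 0. Z \<le> frac_integral \<alpha> \<nu>\<^sub>0 (\<lambda>\<mu>. f \<mu> t) \<nu>"
    proof eventually_elim
      case (elim t)
      let ?q = "\<lambda>\<mu>. Re (num (t / 2) (of_real \<mu>)) / sin (\<mu> * pi)"
      have "t / 2 > 0" using elim by simp
      \<comment> \<open>This bound may depend on \<open>t\<close>; it only secures
        integrability.\<close>
      then obtain B where B: "\<And>\<mu>. 0 \<le> \<mu> \<Longrightarrow> \<mu> \<le> \<nu> \<Longrightarrow> \<mu> \<notin> \<int> \<Longrightarrow> \<bar>?q \<mu>\<bar> \<le> B"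
        using quotient_bounded by metis
      have "Z / W * W \<le> frac_integral \<alpha> \<nu>\<^sub>0 (\<lambda>\<mu>. f \<mu> t) \<nu>"
        unfolding W_def
      proof (rule frac_integral_ge[OF assms(1,3)], fold W_def)
        have "(\<lambda>\<mu>. a * ?q \<mu>) \<in> borel_measurable borel"
          by (intro borel_measurable_times borel_measurable_const quotient_measurable)
        \<comment> \<open>Measurability survives arbitrary values of \<open>f\<close> on the
          countable set of integers.\<close>
        then show "(\<lambda>\<mu>. f \<mu> t) \<in> borel_measurable borel"
          by (rule measurable_discrete_difference[OF _ countable_Ints_real]) (use f[OF elim(2)] in auto)
        fix \<mu> assume \<mu>: "\<nu>\<^sub>0 \<le> \<mu>" "\<mu> \<le> \<nu>" "\<mu> \<notin> \<int>"
        have "Z / W / a \<le> ?q \<mu>" using elim(1) \<mu> assms(2) by auto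
        then have "Z / W \<le> a * ?q \<mu>"
          unfolding pos_divide_le_eq[OF \<open>a > 0\<close>] by (simp only: mult.commute)
        then show "Z / W \<le> f \<mu> t" by (simp only: f[OF elim(2) \<mu>(3)])
        show "\<bar>f \<mu> t\<bar> \<le> a * B"
          using mult_left_mono[OF B[of \<mu>], of a] \<mu> assms(2) \<open>a > 0\<close>
          by (simp only: f[OF elim(2) \<mu>(3)] abs_mult) simp
      qed
      then show ?case using \<open>W > 0\<close> by simp
    qed
  qed
qed

section \<open>The functions of the second kind as instances\<close>

lemma of_real_bessel_J:
  assumes "t > 0"
  shows "complex_of_real (bessel_J \<mu> t) =
    exp (of_real \<mu> * of_real (ln (t / 2))) * bessel_entire (of_real (- 1 * (t / 2)\<^sup>2)) (of_real \<mu>)"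
  using bessel_series_eq[of "t / 2" "- 1" \<mu>] assms by (simp add: bessel_J_def)

lemma of_real_bessel_I:
  assumes "t > 0"
  shows "complex_of_real (bessel_I \<mu> t) =
    exp (of_real \<mu> * of_real (ln (t / 2))) * bessel_entire (of_real (1 * (t / 2)\<^sup>2)) (of_real \<mu>)"
  using bessel_series_eq[of "t / 2" 1 \<mu>] assms by (simp add: bessel_I_def)

interpretation Y: bessel_quotient "- 1" "\<lambda>z. cos (z * of_real pi)" "\<lambda>\<mu>. cos (\<mu> * pi)"
  by unfold_locales (auto intro!: holomorphic_intros simp flip: cos_of_real)

interpretation K: bessel_quotient 1 "\<lambda>_. 1" "\<lambda>_. 1"
  by unfold_locales auto

theorem mainTheorem13:
  fixes \<alpha> \<nu>\<^sub>0 \<nu> :: real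
  assumes "\<alpha> > 0" and "0 \<le> \<nu>\<^sub>0" and "\<nu>\<^sub>0 < \<nu>"
  shows "filterlim (\<lambda>t. frac_integral \<alpha> \<nu>\<^sub>0 (\<lambda>\<mu>. bessel_Y \<mu> t) \<nu>) at_bot (at_right 0)
       \<and> filterlim (\<lambda>t. frac_integral \<alpha> \<nu>\<^sub>0 (\<lambda>\<mu>. bessel_K \<mu> t) \<nu>) at_top (at_right 0)"
proof
  have "- bessel_Y \<mu> t = 1 * (Re (Y.num (t / 2) (of_real \<mu>)) / sin (\<mu> * pi))"
    if "t > 0" "\<mu> \<notin> \<int>" for t \<mu>
  proof -
    have "Y.num (t / 2) (of_real \<mu>) = of_real (bessel_J (- \<mu>) t - cos (\<mu> * pi) * bessel_J \<mu> t)"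
      by (simp add: Y.num_def of_real_bessel_J[OF that(1)] flip: cos_of_real)
    then have "Re (Y.num (t / 2) (of_real \<mu>)) = bessel_J (- \<mu>) t - cos (\<mu> * pi) * bessel_J \<mu> t"
      by (simp only: Re_complex_of_real)
    then show ?thesis using that by (simp add: bessel_Y_def diff_divide_distrib mult.commute)
  qed
  \<comment> \<open>Divergence to infinity is obtained for \<open>-Y\<close> with
    \<open>a = 1\<close>; linearity of the integral then reverses the sign.\<close>
  from Y.frac_integral_at_top[OF assms zero_less_one this]
  show "filterlim (\<lambda>t. frac_integral \<alpha> \<nu>\<^sub>0 (\<lambda>\<mu>. bessel_Y \<mu> t) \<nu>) at_bot (at_right 0)"
    by (simp add: frac_integral_uminus filterlim_uminus_at_bot)
  have "bessel_K \<mu> t = pi / 2 * (Re (K.num (t / 2) (of_real \<mu>)) / sin (\<mu> * pi))"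
    if "t > 0" "\<mu> \<notin> \<int>" for t \<mu>
  proof -
    have "K.num (t / 2) (of_real \<mu>) = of_real (bessel_I (- \<mu>) t - bessel_I \<mu> t)"
      by (simp add: K.num_def of_real_bessel_I[OF that(1)])
    then have "Re (K.num (t / 2) (of_real \<mu>)) = bessel_I (- \<mu>) t - bessel_I \<mu> t"
      by (simp only: Re_complex_of_real)
    then show ?thesis using that by (simp add: bessel_K_def)
  qed
  from K.frac_integral_at_top[OF assms _ this]
  show "filterlim (\<lambda>t. frac_integral \<alpha> \<nu>\<^sub>0 (\<lambda>\<mu>. bessel_K \<mu> t) \<nu>) at_top (at_right 0)"
    by simp
qed

end
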